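(* Let $\Sigma$ be a word-hyperbolic structure, with $A=A(\Sigma)$ and $L=L(\Sigma)$, admitting interpretations $\phi:A^+\to S$ and $\psi:A^+\to T$ with respect to semigroups $S$ and $T$, with both $\phi|_A$ and $\psi|_A$ being injections. Then there is an isomorphism $\tau$ from $S$ to $T$ such that $\phi|_L\tau=\psi|_L$.
   Context: Maps are written on the right and composed left to right. For a word $u=a_1\cdots a_n$, $u^{\mathrm{rev}}=a_n\cdots a_1$, and $L^{\mathrm{rev}}=\{w^{\mathrm{rev}} : w\in L\}$. $A^+$ is the set of non-empty words over $A$. A pre-word-hyperbolic structure $\Sigma$ consists of: a finite alphabet $A(\Sigma)$; a regular language $L(\Sigma)$ over $A(\Sigma)$ not containing the empty word; and a context-free language $M(\Sigma)$ over $A(\Sigma)\cup\{\#_1,\#_2\}$, where $\#_1,\#_2$ are new symbols not in $A(\Sigma)$, such that $M(\Sigma)\subseteq L(\Sigma)\#_1L(\Sigma)\#_2L(\Sigma)^{\mathrm{rev}}$. In this statement, an interpretation of $\Sigma$ with respect to a semigroup $S$ is a homomorphism $\phi:A(\Sigma)^+\to S$ such that $(L(\Sigma))\phi=S$ and $M(\Sigma)=\{u\#_1v\#_2w^{\mathrm{rev}} : u,v,w\in L(\Sigma),\ (u\phi)(v\phi)=w\phi\}$ (injectivity on $A(\Sigma)$ is not part of the definition, and is assumed explicitly). If $\Sigma$ admits an interpretation with respect to some semigroup $S$, it is a word-hyperbolic structure (for $S$). *)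

theory Defs
  imports "HOL-Algebra.Group"
begin

section \<open>Regular and context-free languages\<close>

text \<open>State sets and nonterminal sets are finite, so taking them inside \<^typ>\<open>nat\<close> loses no
  generality; it avoids quantifying over types inside the definitions.\<close>

definition regular_language :: "'a set \<Rightarrow> 'a list set \<Rightarrow> bool" where
  "regular_language A L \<longleftrightarrow>
     (\<exists>(Q :: nat set) \<delta> q0 F.
        finite Q \<and> q0 \<in> Q \<and> F \<subseteq> Q \<and> (\<forall>q\<in>Q. \<forall>a\<in>A. \<delta> q a \<in> Q) \<and>
        L = {w \<in> lists A. foldl \<delta> q0 w \<in> F})"

text \<open>In sentential forms, \<^term>\<open>Inl\<close> marks terminals and \<^term>\<open>Inr\<close> marks nonterminals.\<close>

definition derivation_step ::
    "('n \<times> ('t + 'n) list) set \<Rightarrow> (('t + 'n) list \<times> ('t + 'n) list) set" where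
  "derivation_step P = {(x @ [Inr X] @ y, x @ \<alpha> @ y) | x X \<alpha> y. (X, \<alpha>) \<in> P}"

definition context_free_language :: "'t set \<Rightarrow> 't list set \<Rightarrow> bool" where
  "context_free_language T M \<longleftrightarrow>
     (\<exists>(N :: nat set) P X0.
        finite N \<and> finite P \<and> X0 \<in> N \<and> P \<subseteq> N \<times> lists (Inl ` T \<union> Inr ` N) \<and>
        M = {w \<in> lists T. ([Inr X0], map Inl w) \<in> (derivation_step P)\<^sup>*})"


section \<open>Semigroups\<close>

text \<open>Semigroups are represented by the record of monoids, so that \<^const>\<open>hom\<close> and
  \<^const>\<open>iso\<close> apply; neither of these, nor the following locale, refers to the
  field \<^const>\<open>one\<close>, whose value is arbitrary and may lie outside the carrier.\<close>

locale carrier_semigroup =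
  fixes S (structure)
  assumes mult_closed: "\<lbrakk>x \<in> carrier S; y \<in> carrier S\<rbrakk> \<Longrightarrow> x \<otimes> y \<in> carrier S"
      and mult_assoc: "\<lbrakk>x \<in> carrier S; y \<in> carrier S; z \<in> carrier S\<rbrakk>
             \<Longrightarrow> (x \<otimes> y) \<otimes> z = x \<otimes> (y \<otimes> z)"

definition free_semigroup :: "'a set \<Rightarrow> 'a list monoid" where
  "free_semigroup A = \<lparr>carrier = lists A - {[]}, mult = (@), one = []\<rparr>"


section \<open>Word-hyperbolic structures\<close>

text \<open>The two separators are new constructors, hence automatically not in the alphabet.\<close>

datatype 'a hashed = Letter 'a | Hash1 | Hash2

definition hash_word :: "'a list \<Rightarrow> 'a list \<Rightarrow> 'a list \<Rightarrow> 'a hashed list" where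
  "hash_word u v x = map Letter u @ [Hash1] @ map Letter v @ [Hash2] @ map Letter x"

record 'a wh_structure =
  alphabet :: "'a set"
  rep_lang :: "'a list set"
  mult_lang :: "'a hashed list set"

definition pre_word_hyperbolic_structure :: "'a wh_structure \<Rightarrow> bool" where
  "pre_word_hyperbolic_structure \<Sigma> \<longleftrightarrow>
     finite (alphabet \<Sigma>) \<and>
     regular_language (alphabet \<Sigma>) (rep_lang \<Sigma>) \<and> [] \<notin> rep_lang \<Sigma> \<and>
     context_free_language (Letter ` alphabet \<Sigma> \<union> {Hash1, Hash2}) (mult_lang \<Sigma>) \<and>
     mult_lang \<Sigma> \<subseteq>
       {hash_word u v x | u v x. u \<in> rep_lang \<Sigma> \<and> v \<in> rep_lang \<Sigma> \<and> x \<in> rev ` rep_lang \<Sigma>}"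

definition is_interpretation ::
    "'a wh_structure \<Rightarrow> ('s, 'm) monoid_scheme \<Rightarrow> ('a list \<Rightarrow> 's) \<Rightarrow> bool" where
  "is_interpretation \<Sigma> S \<phi> \<longleftrightarrow>
     carrier_semigroup S \<and>
     \<phi> \<in> hom (free_semigroup (alphabet \<Sigma>)) S \<and>
     \<phi> ` rep_lang \<Sigma> = carrier S \<and>
     mult_lang \<Sigma> =
       {hash_word u v (rev w) | u v w. u \<in> rep_lang \<Sigma> \<and> v \<in> rep_lang \<Sigma> \<and> w \<in> rep_lang \<Sigma> \<and>
          \<phi> u \<otimes>\<^bsub>S\<^esub> \<phi> v = \<phi> w}"

definition word_hyperbolic_structure_for ::
    "'a wh_structure \<Rightarrow> ('s, 'm) monoid_scheme \<Rightarrow> bool" where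
  "word_hyperbolic_structure_for \<Sigma> S \<longleftrightarrow>
     pre_word_hyperbolic_structure \<Sigma> \<and> (\<exists>\<phi>. is_interpretation \<Sigma> S \<phi>)"

end

theory Submission
  imports Defs
begin

text \<open>The language \<open>M\<close> records which triples in \<open>L\<close> multiply correctly, so both interpretations
  agree on products of representatives. They also agree on which words of \<open>L\<close> represent equal
  elements: a decomposable element is determined by a factorization, which \<open>M\<close> sees, and an
  indecomposable one can only be represented by a single letter, where injectivity on \<open>A\<close> applies.\<close>

text \<open>The first symbol outside \<open>range Letter\<close> marks where the prefix
  ends.\<close>

lemma map_Letter_append_eq_iff:
  assumes "p \<notin> range Letter" and "p' \<notin> range Letter"
  shows "map Letter u @ p # x = map Letter u' @ p' # x' \<longleftrightarrow> u = u' \<and> p = p' \<and> x = x'"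
proof (induction u arbitrary: u')
  case Nil
  then show ?case using assms by (cases u') auto
next
  case (Cons a u)
  then show ?case using assms by (cases u') auto
qed

lemma hash_word_eq_iff: "hash_word u v x = hash_word u' v' x' \<longleftrightarrow> u = u' \<and> v = v' \<and> x = x'"
proof -
  have "map Letter x = map Letter x' \<longleftrightarrow> x = x'"
    by (simp add: inj_map_eq_map inj_on_def)
  then show ?thesis
    by (auto simp: hash_word_def map_Letter_append_eq_iff image_iff)
qed

text \<open>Unique parsing of hashed words excludes membership via another triple. As the left side
  mentions only \<open>\<Sigma>\<close>, any two interpretations can be compared through it.\<close>

lemma interpretation_mult_iff:
  assumes "is_interpretation \<Sigma> S \<phi>"
    and "u \<in> rep_lang \<Sigma>" and "v \<in> rep_lang \<Sigma>" and "w \<in> rep_lang \<Sigma>"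
  shows "hash_word u v (rev w) \<in> mult_lang \<Sigma> \<longleftrightarrow> \<phi> u \<otimes>\<^bsub>S\<^esub> \<phi> v = \<phi> w"
proof -
  have M: "mult_lang \<Sigma> = {hash_word u v (rev w) | u v w.
      u \<in> rep_lang \<Sigma> \<and> v \<in> rep_lang \<Sigma> \<and> w \<in> rep_lang \<Sigma> \<and> \<phi> u \<otimes>\<^bsub>S\<^esub> \<phi> v = \<phi> w}"
    using assms(1) unfolding is_interpretation_def by blast
  show ?thesis
    using assms(2-4) by (auto simp: M hash_word_eq_iff)
qed

lemma rep_lang_word:
  assumes "pre_word_hyperbolic_structure \<Sigma>" and "w \<in> rep_lang \<Sigma>"
  shows "w \<in> lists (alphabet \<Sigma>)" and "w \<noteq> []"
  using assms by (auto simp: pre_word_hyperbolic_structure_def regular_language_def)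

text \<open>A word that is not a single letter splits after its first letter. The two pieces may lie
  outside \<open>rep_lang \<Sigma>\<close>, but surjectivity supplies representatives of their
  values.\<close>

lemma interpretation_decompose:
  assumes "pre_word_hyperbolic_structure \<Sigma>" and "is_interpretation \<Sigma> S \<phi>"
    and "w \<in> rep_lang \<Sigma>" and "\<nexists>a. a \<in> alphabet \<Sigma> \<and> w = [a]"
  obtains u v where "u \<in> rep_lang \<Sigma>" and "v \<in> rep_lang \<Sigma>" and "\<phi> u \<otimes>\<^bsub>S\<^esub> \<phi> v = \<phi> w"
proof -
  from rep_lang_word[OF assms(1,3)] assms(4) obtain a x
    where w: "w = [a] @ x" and a: "a \<in> alphabet \<Sigma>" and x: "x \<in> lists (alphabet \<Sigma>)" "x \<noteq> []"
    by (cases w) auto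
  have hom: "\<phi> \<in> hom (free_semigroup (alphabet \<Sigma>)) S" and onto: "\<phi> ` rep_lang \<Sigma> = carrier S"
    using assms(2) by (auto simp: is_interpretation_def)
  from a have a': "[a] \<in> carrier (free_semigroup (alphabet \<Sigma>))"
    by (simp add: free_semigroup_def)
  from x have x': "x \<in> carrier (free_semigroup (alphabet \<Sigma>))"
    by (simp add: free_semigroup_def)
  have "\<phi> w = \<phi> [a] \<otimes>\<^bsub>S\<^esub> \<phi> x"
    using hom_mult[OF hom a' x'] by (simp add: w free_semigroup_def)
  moreover have "\<phi> [a] \<in> \<phi> ` rep_lang \<Sigma>" "\<phi> x \<in> \<phi> ` rep_lang \<Sigma>"
    unfolding onto using hom_in_carrier[OF hom] a' x' by auto
  ultimately show thesis
    using that by force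
qed

text \<open>One inclusion between the kernels on \<open>rep_lang \<Sigma>\<close>; exchanging the
  two interpretations gives the other.\<close>

lemma interpretation_kernel_mono:
  assumes "pre_word_hyperbolic_structure \<Sigma>"
    and "is_interpretation \<Sigma> S \<phi>" and "is_interpretation \<Sigma> T \<psi>"
    and "inj_on (\<lambda>a. \<phi> [a]) (alphabet \<Sigma>)"
    and "w \<in> rep_lang \<Sigma>" and "w' \<in> rep_lang \<Sigma>" and "\<phi> w = \<phi> w'"
  shows "\<psi> w = \<psi> w'"
proof (cases "\<exists>u\<in>rep_lang \<Sigma>. \<exists>v\<in>rep_lang \<Sigma>. \<phi> u \<otimes>\<^bsub>S\<^esub> \<phi> v = \<phi> w")
  case True
  then obtain u v where uv: "u \<in> rep_lang \<Sigma>" "v \<in> rep_lang \<Sigma>" "\<phi> u \<otimes>\<^bsub>S\<^esub> \<phi> v = \<phi> w"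
    by blast
  \<comment> \<open>The factors \<open>u\<close> and \<open>v\<close> stay fixed while
    \<open>x\<close> varies, so \<open>\<psi>\<close> sends all representatives of
    \<open>\<phi> w\<close> to one product.\<close>
  have "\<psi> u \<otimes>\<^bsub>T\<^esub> \<psi> v = \<psi> x" if "x \<in> rep_lang \<Sigma>" "\<phi> x = \<phi> w" for x
    using uv that interpretation_mult_iff[OF assms(2) uv(1,2) that(1)]
      interpretation_mult_iff[OF assms(3) uv(1,2) that(1)] by simp
  from this[of w] this[of w'] assms(5-7) show ?thesis by simp
next
  case False
  \<comment> \<open>Any other representative would split, giving the factorization of
    \<open>\<phi> w\<close> just excluded.\<close>
  have "\<exists>a\<in>alphabet \<Sigma>. x = [a]" if "x \<in> rep_lang \<Sigma>" "\<phi> x = \<phi> w" for x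
    using interpretation_decompose[OF assms(1,2) that(1)] False that(2) by auto
  from this[of w] this[of w'] assms(5-7) obtain a b
    where "a \<in> alphabet \<Sigma>" "w = [a]" "b \<in> alphabet \<Sigma>" "w' = [b]"
    by auto
  then show ?thesis
    using assms(4,7) by (auto dest: inj_onD)
qed

theorem proposition3p5:
  fixes \<Sigma> :: "'a wh_structure"
    and S :: "('s, 'm) monoid_scheme" and T :: "('t, 'n) monoid_scheme"
    and \<phi> :: "'a list \<Rightarrow> 's" and \<psi> :: "'a list \<Rightarrow> 't"
  assumes "word_hyperbolic_structure_for \<Sigma> S" and "word_hyperbolic_structure_for \<Sigma> T"
    and "is_interpretation \<Sigma> S \<phi>" and "is_interpretation \<Sigma> T \<psi>"
    and "inj_on (\<lambda>a. \<phi> [a]) (alphabet \<Sigma>)" and "inj_on (\<lambda>a. \<psi> [a]) (alphabet \<Sigma>)"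
  shows "\<exists>\<tau> \<in> iso S T. \<forall>w \<in> rep_lang \<Sigma>. \<tau> (\<phi> w) = \<psi> w"
proof -
  let ?L = "rep_lang \<Sigma>"
  have pre: "pre_word_hyperbolic_structure \<Sigma>"
    using assms(1) by (simp add: word_hyperbolic_structure_for_def)
  have S: "\<phi> ` ?L = carrier S" and T: "\<psi> ` ?L = carrier T"
    using assms(3,4) by (simp_all add: is_interpretation_def)
  have ker: "\<phi> w = \<phi> w' \<longleftrightarrow> \<psi> w = \<psi> w'" if "w \<in> ?L" "w' \<in> ?L" for w w'
    using interpretation_kernel_mono[OF pre assms(3,4,5) that]
      interpretation_kernel_mono[OF pre assms(4,3,6) that] by blast
  \<comment> \<open>\<open>inv_into\<close> picks some representative of \<open>s\<close>; by
    \<open>ker\<close> the choice does not affect the value.\<close>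
  define \<tau> where "\<tau> s = \<psi> (inv_into ?L \<phi> s)" for s
  have \<tau>: "\<tau> (\<phi> w) = \<psi> w" if "w \<in> ?L" for w
    unfolding \<tau>_def using that by (simp add: inv_into_into f_inv_into_f flip: ker)
  have "\<tau> (\<phi> u \<otimes>\<^bsub>S\<^esub> \<phi> v) = \<tau> (\<phi> u) \<otimes>\<^bsub>T\<^esub> \<tau> (\<phi> v)" if uv: "u \<in> ?L" "v \<in> ?L" for u v
  proof -
    interpret carrier_semigroup S
      using assms(3) by (simp add: is_interpretation_def)
    \<comment> \<open>The product need not be represented by \<open>u @ v\<close> within
      \<open>rep_lang \<Sigma>\<close>, so a representative \<open>w\<close> is taken from
      surjectivity.\<close>
    have "\<phi> u \<otimes>\<^bsub>S\<^esub> \<phi> v \<in> \<phi> ` ?L"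
      using mult_closed uv unfolding S[symmetric] by blast
    then obtain w where w: "w \<in> ?L" "\<phi> u \<otimes>\<^bsub>S\<^esub> \<phi> v = \<phi> w"
      by blast
    with uv have "\<psi> u \<otimes>\<^bsub>T\<^esub> \<psi> v = \<psi> w"
      using interpretation_mult_iff[OF assms(3) uv w(1)] interpretation_mult_iff[OF assms(4) uv w(1)]
      by simp
    with uv w show ?thesis by (simp add: \<tau>)
  qed
  then have "\<tau> \<in> hom S T"
    unfolding hom_def S[symmetric] T[symmetric] by (auto simp: \<tau>)
  \<comment> \<open>Well-definedness used one direction of \<open>ker\<close>; injectivity is the
    other.\<close>
  moreover have "inj_on \<tau> (carrier S)"
    unfolding S[symmetric] by (auto simp: inj_on_def \<tau> ker)
  moreover have "\<tau> ` carrier S = carrier T"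
    unfolding S[symmetric] T[symmetric] by (simp add: image_image \<tau>)
  ultimately have "\<tau> \<in> iso S T"
    by (simp add: iso_def bij_betw_def)
  with \<tau> show ?thesis by blast
qed

end
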